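(* $$\max_{y\in\mathcal{P}}F(y)\ \ge\ \Big(1-\frac1e\Big)\,\mathrm{OPT},$$ where $\mathrm{OPT}$ is the optimal social welfare of the generalized assignment problem, and $F$ and $\mathcal{P}$ are as defined in the context.
   Context: Generalized assignment problem: bins $I=\{1,\dots,n\}$, items $J=\{1,\dots,m\}$, values $v_{ij}\ge0$, weights $w_{ij}\ge0$, capacities $C_i\ge0$. $\mathcal{F}_i=\{S\subseteq J:\sum_{j\in S}w_{ij}\le C_i\}$. A feasible allocation is a tuple $(S_1,\dots,S_n)$ of mutually disjoint sets with $S_i\in\mathcal{F}_i$; $\mathrm{OPT}$ is the maximum of $\sum_{i\in I}\sum_{j\in S_i}v_{ij}$ over feasible allocations. $\mathcal{R}$ is the set of all $x=(x_{i,S})\in[0,1]^{I\times 2^J}$ with $x_{i,S}=0$ for $S\notin\mathcal{F}_i$ and $\sum_{S\in\mathcal{F}_i}x_{i,S}\le1$ for every $i\in I$. Define $\phi:\mathcal{R}\to[0,1]^{I\times J}$ by $\phi(x)_{ij}=\sum_{S: j\in S}x_{i,S}$, and $\mathcal{P}=\phi(\mathcal{R})$. For each item $j$ let $\sigma_j$ be a permutation of $I$ such that $v_{\sigma_j(i),j}$ is non-increasing as $i$ runs from $1$ to $n$, with the convention $v_{\sigma_j(n+1),j}=0$. Define $F:[0,1]^{I\times J}\to\mathbb{R}_{\ge0}$ by $$F(y)=\sum_{j=1}^m\sum_{i=1}^n\big(v_{\sigma_j(i),j}-v_{\sigma_j(i+1),j}\big)\Big(1-\exp\big(-\sum_{k=1}^i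 y_{\sigma_j(k),j}\big)\Big).$$ *)

theory Defs
  imports "HOL-Analysis.Analysis"
begin

text \<open>
  Generalized assignment problem with bins \<open>{1..n}\<close> and items \<open>{1..m}\<close>; \<open>v i j\<close> and \<open>w i j\<close> are
  the value and the weight of item \<open>j\<close> in bin \<open>i\<close>, and \<open>C i\<close> is the capacity of bin \<open>i\<close>.
  Families indexed by a finite set are extensional functions on that set (\<open>PiE\<close>, \<open>restrict\<close>),
  so that the values of \<open>v\<close>, \<open>w\<close>, \<open>C\<close> outside their index ranges play no role.
\<close>

definition gap_feasible_sets ::
    "nat \<Rightarrow> (nat \<Rightarrow> nat \<Rightarrow> real) \<Rightarrow> (nat \<Rightarrow> real) \<Rightarrow> nat \<Rightarrow> nat set set" where
  "gap_feasible_sets m w C i = {S. S \<subseteq> {1..m} \<and> (\<Sum>j\<in>S. w i j) \<le> C i}"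

definition gap_allocations ::
    "nat \<Rightarrow> nat \<Rightarrow> (nat \<Rightarrow> nat \<Rightarrow> real) \<Rightarrow> (nat \<Rightarrow> real) \<Rightarrow> (nat \<Rightarrow> nat set) set" where
  "gap_allocations n m w C =
     {A \<in> (\<Pi>\<^sub>E i\<in>{1..n}. gap_feasible_sets m w C i). disjoint_family_on A {1..n}}"

definition gap_welfare ::
    "nat \<Rightarrow> (nat \<Rightarrow> nat \<Rightarrow> real) \<Rightarrow> (nat \<Rightarrow> nat set) \<Rightarrow> real" where
  "gap_welfare n v A = (\<Sum>i\<in>{1..n}. \<Sum>j\<in>A i. v i j)"

definition gap_OPT ::
    "nat \<Rightarrow> nat \<Rightarrow> (nat \<Rightarrow> nat \<Rightarrow> real) \<Rightarrow> (nat \<Rightarrow> nat \<Rightarrow> real) \<Rightarrow> (nat \<Rightarrow> real) \<Rightarrow> real" where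
  "gap_OPT n m v w C = Max (gap_welfare n v ` gap_allocations n m w C)"

text \<open>The maximum in \<open>gap_OPT\<close> is taken over a finite nonempty set.\<close>

lemma finite_gap_allocations: "finite (gap_allocations n m w C)"
proof -
  have "finite (gap_feasible_sets m w C i)" for i
    by (rule finite_subset[of _ "Pow {1..m}"]) (auto simp: gap_feasible_sets_def)
  then have "finite (\<Pi>\<^sub>E i\<in>{1..n}. gap_feasible_sets m w C i)"
    by (intro finite_PiE) auto
  then show ?thesis
    by (rule rev_finite_subset) (auto simp: gap_allocations_def)
qed

lemma gap_allocations_nonempty:
  assumes "\<And>i. i \<in> {1..n} \<Longrightarrow> 0 \<le> C i"
  shows "gap_allocations n m w C \<noteq> {}"
proof -
  have "(\<lambda>i\<in>{1..n}. {}) \<in> gap_allocations n m w C"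
    using assms by (auto simp: gap_allocations_def gap_feasible_sets_def disjoint_family_on_def)
  then show ?thesis by blast
qed

definition gap_R ::
    "nat \<Rightarrow> nat \<Rightarrow> (nat \<Rightarrow> nat \<Rightarrow> real) \<Rightarrow> (nat \<Rightarrow> real) \<Rightarrow> (nat \<times> nat set \<Rightarrow> real) set" where
  "gap_R n m w C =
     {x \<in> ({1..n} \<times> Pow {1..m}) \<rightarrow>\<^sub>E {0..1}.
        (\<forall>i\<in>{1..n}. \<forall>S\<in>Pow {1..m} - gap_feasible_sets m w C i. x (i, S) = 0) \<and>
        (\<forall>i\<in>{1..n}. (\<Sum>S\<in>gap_feasible_sets m w C i. x (i, S)) \<le> 1)}"

definition gap_phi ::
    "nat \<Rightarrow> nat \<Rightarrow> (nat \<times> nat set \<Rightarrow> real) \<Rightarrow> (nat \<times> nat \<Rightarrow> real)" where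
  "gap_phi n m x = (\<lambda>(i, j)\<in>{1..n} \<times> {1..m}. \<Sum>S\<in>{S \<in> Pow {1..m}. j \<in> S}. x (i, S))"

definition gap_P ::
    "nat \<Rightarrow> nat \<Rightarrow> (nat \<Rightarrow> nat \<Rightarrow> real) \<Rightarrow> (nat \<Rightarrow> real) \<Rightarrow> (nat \<times> nat \<Rightarrow> real) set" where
  "gap_P n m w C = gap_phi n m ` gap_R n m w C"

text \<open>
  \<open>\<sigma> j\<close> lists the bins by non-increasing value for item \<open>j\<close>; \<open>gap_sorted_value\<close> is the \<open>i\<close>-th
  value in this order, with the convention that the \<open>(n+1)\<close>-st value is \<open>0\<close>.
\<close>

definition gap_sorting ::
    "nat \<Rightarrow> nat \<Rightarrow> (nat \<Rightarrow> nat \<Rightarrow> real) \<Rightarrow> (nat \<Rightarrow> nat \<Rightarrow> nat) \<Rightarrow> bool" where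
  "gap_sorting n m v \<sigma> \<longleftrightarrow>
     (\<forall>j\<in>{1..m}. \<sigma> j permutes {1..n} \<and> antimono_on {1..n} (\<lambda>i. v (\<sigma> j i) j))"

definition gap_sorted_value ::
    "nat \<Rightarrow> (nat \<Rightarrow> nat \<Rightarrow> real) \<Rightarrow> (nat \<Rightarrow> nat \<Rightarrow> nat) \<Rightarrow> nat \<Rightarrow> nat \<Rightarrow> real" where
  "gap_sorted_value n v \<sigma> j i = (if i \<le> n then v (\<sigma> j i) j else 0)"

definition gap_F ::
    "nat \<Rightarrow> nat \<Rightarrow> (nat \<Rightarrow> nat \<Rightarrow> real) \<Rightarrow> (nat \<Rightarrow> nat \<Rightarrow> nat) \<Rightarrow> (nat \<times> nat \<Rightarrow> real) \<Rightarrow> real" where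
  "gap_F n m v \<sigma> y =
     (\<Sum>j=1..m. \<Sum>i=1..n.
        (gap_sorted_value n v \<sigma> j i - gap_sorted_value n v \<sigma> j (i + 1)) *
        (1 - exp (- (\<Sum>k=1..i. y (\<sigma> j k, j)))))"

end

theory Submission
  imports Defs
begin

text \<open>
  Grouping the terms of \<open>F\<close> by Abel summation turns its linearisation, in which
  \<open>1 - exp (- t)\<close> is replaced by \<open>t\<close>, into \<open>\<Sum> v i j * y (i, j)\<close>. If every item is used at most
  once, the partial sums \<open>t\<close> lie in \<open>[0, 1]\<close>, where concavity gives
  \<open>1 - exp (- t) \<ge> (1 - 1 / exp 1) * t\<close>. Applied to the 0/1 point of \<open>P\<close> given by an optimal
  allocation, this yields the bound; the maximum exists because \<open>R\<close> is compact in the product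
  topology.
\<close>

lemma sum_Abel:
  fixes g z :: "nat \<Rightarrow> 'a::comm_ring"
  shows "(\<Sum>i=1..n. (g i - g (i + 1)) * (\<Sum>k=1..i. z k)) =
    (\<Sum>k=1..n. g k * z k) - g (n + 1) * (\<Sum>k=1..n. z k)"
  by (induction n) (auto simp: algebra_simps)

lemma one_minus_exp_neg_ge:
  fixes t :: real
  assumes "0 \<le> t" "t \<le> 1"
  shows "(1 - 1 / exp 1) * t \<le> 1 - exp (- t)"
proof -
  \<comment> \<open>Write \<open>- t\<close> as the convex combination of \<open>0\<close> and
    \<open>-1\<close> with weight \<open>t\<close>; the chord of \<open>exp\<close> between these
    points gives the constant \<open>1 - 1 / exp 1\<close>.\<close>
  have "exp ((1 - t) *\<^sub>R 0 + t *\<^sub>R (-1)) \<le> (1 - t) * exp 0 + t * exp (-1 :: real)"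
    using convex_onD[OF exp_convex, of t 0 "-1"] assms by simp
  then show ?thesis
    by (simp add: exp_minus field_simps)
qed

text \<open>Below \<open>n\<close> this is the sorting; at \<open>i = n\<close> the next value is
  the default \<open>0\<close>, and nonnegativity of \<open>v\<close> takes over. It makes the
  coefficients in \<open>gap_F\<close> nonnegative.\<close>

lemma gap_sorted_value_antimono:
  assumes "gap_sorting n m v \<sigma>" "j \<in> {1..m}" "i \<in> {1..n}"
    and "\<And>i. i \<in> {1..n} \<Longrightarrow> 0 \<le> v i j"
  shows "gap_sorted_value n v \<sigma> j (i + 1) \<le> gap_sorted_value n v \<sigma> j i"
proof -
  have perm: "\<sigma> j permutes {1..n}" and anti: "antimono_on {1..n} (\<lambda>i. v (\<sigma> j i) j)"
    using assms(1,2) by (auto simp: gap_sorting_def)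
  have "0 \<le> v (\<sigma> j i) j"
    using permutes_in_image[OF perm, of i] assms(3,4) by blast
  moreover have "v (\<sigma> j (i + 1)) j \<le> v (\<sigma> j i) j" if "i + 1 \<le> n"
    using monotone_onD[OF anti, of i "i + 1"] assms(3) that by auto
  ultimately show ?thesis
    using assms(3) by (auto simp: gap_sorted_value_def)
qed

text \<open>Points of \<open>gap_P\<close> may have column sums above 1, since different bins can
  use the same item there. The bound on \<open>1 - exp (- t)\<close> needs \<open>t \<le> 1\<close>,
  hence \<open>y1\<close>.\<close>

lemma gap_F_ge_linear:
  assumes "\<And>i j. i \<in> {1..n} \<Longrightarrow> j \<in> {1..m} \<Longrightarrow> 0 \<le> v i j"
    and \<sigma>: "gap_sorting n m v \<sigma>"
    and y0: "\<And>i j. i \<in> {1..n} \<Longrightarrow> j \<in> {1..m} \<Longrightarrow> 0 \<le> y (i, j)"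
    and y1: "\<And>j. j \<in> {1..m} \<Longrightarrow> (\<Sum>i=1..n. y (i, j)) \<le> 1"
  shows "(1 - 1 / exp 1) * (\<Sum>i=1..n. \<Sum>j=1..m. v i j * y (i, j)) \<le> gap_F n m v \<sigma> y"
proof -
  have "(1 - 1 / exp 1) * (\<Sum>i=1..n. v i j * y (i, j)) \<le>
      (\<Sum>i=1..n. (gap_sorted_value n v \<sigma> j i - gap_sorted_value n v \<sigma> j (i + 1)) *
        (1 - exp (- (\<Sum>k=1..i. y (\<sigma> j k, j)))))" if j: "j \<in> {1..m}" for j
  proof -
    have perm: "\<sigma> j permutes {1..n}"
      using \<sigma> j by (auto simp: gap_sorting_def)
    let ?g = "gap_sorted_value n v \<sigma> j" and ?t = "\<lambda>i. \<Sum>k=1..i. y (\<sigma> j k, j)"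
    have y\<sigma>: "0 \<le> y (\<sigma> j k, j)" if "k \<in> {1..n}" for k
      using y0 j that permutes_in_image[OF perm] by blast
    have "?t n = (\<Sum>i=1..n. y (i, j))"
      using sum.permute[OF perm, of "\<lambda>i. y (i, j)"] by (simp add: o_def)
    then have tn: "?t n \<le> 1"
      using y1[OF j] by simp
    have "(\<Sum>i=1..n. v i j * y (i, j)) = (\<Sum>k=1..n. ?g k * y (\<sigma> j k, j))"
      using sum.permute[OF perm, of "\<lambda>i. v i j * y (i, j)"]
      by (simp add: o_def gap_sorted_value_def)
    \<comment> \<open>The boundary term of \<open>sum_Abel\<close> vanishes because the sorted value
      at \<open>n + 1\<close> is \<open>0\<close>.\<close>
    also have "\<dots> = (\<Sum>i=1..n. (?g i - ?g (i + 1)) * ?t i)"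
      unfolding sum_Abel by (simp add: gap_sorted_value_def)
    finally have "(1 - 1 / exp 1) * (\<Sum>i=1..n. v i j * y (i, j)) =
        (\<Sum>i=1..n. (?g i - ?g (i + 1)) * ((1 - 1 / exp 1) * ?t i))"
      by (simp add: sum_distrib_left mult.left_commute)
    also have "\<dots> \<le> (\<Sum>i=1..n. (?g i - ?g (i + 1)) * (1 - exp (- ?t i)))"
    proof (intro sum_mono mult_left_mono one_minus_exp_neg_ge)
      fix i assume i: "i \<in> {1..n}"
      show "0 \<le> ?t i"
        using i y\<sigma> by (intro sum_nonneg) auto
      \<comment> \<open>Partial sums of nonnegative terms increase, and the last one is the whole
        column sum, as \<open>\<sigma> j\<close> only reorders the bins.\<close>
      have "?t i \<le> ?t n"
        using i y\<sigma> by (intro sum_mono2) auto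
      then show "?t i \<le> 1"
        using tn by linarith
      show "0 \<le> ?g i - ?g (i + 1)"
        using gap_sorted_value_antimono[OF \<sigma> j i] assms(1) j by fastforce
    qed
    finally show ?thesis .
  qed
  then have "(\<Sum>j=1..m. (1 - 1 / exp 1) * (\<Sum>i=1..n. v i j * y (i, j))) \<le> gap_F n m v \<sigma> y"
    unfolding gap_F_def by (intro sum_mono) auto
  then show ?thesis
    by (subst sum.swap) (simp add: sum_distrib_left)
qed

text \<open>Extensionality pins every coordinate outside \<open>A\<close> to
  \<open>undefined\<close>, so the set is a full product whose remaining factors are singletons, and
  Tychonoff applies.\<close>

lemma compact_PiE_fun:
  fixes B :: "'b::topological_space set"
  assumes "compact B"
  shows "compact (A \<rightarrow>\<^sub>E B)"
proof -
  have "(A \<rightarrow>\<^sub>E B) = PiE UNIV (\<lambda>a. if a \<in> A then B else {undefined})"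
    by (auto simp: PiE_iff extensional_def split: if_splits)
  moreover have "compactin (product_topology (\<lambda>a. euclidean) UNIV)
      (PiE UNIV (\<lambda>a::'a. if a \<in> A then B else {undefined}))"
    unfolding compactin_PiE using assms by auto
  ultimately show ?thesis
    by (simp add: euclidean_product_topology)
qed

lemma compact_gap_R: "compact (gap_R n m w C)"
proof -
  let ?F = "gap_feasible_sets m w C"
  have "closed {x :: nat \<times> nat set \<Rightarrow> real.
      (\<forall>i\<in>{1..n}. \<forall>S\<in>Pow {1..m} - ?F i. x (i, S) = 0) \<and>
      (\<forall>i\<in>{1..n}. (\<Sum>S\<in>?F i. x (i, S)) \<le> 1)}"
    \<comment> \<open>Bounded quantifiers become implications whose premises do not depend on
      \<open>x\<close>; such a premise defines an open set, so the implication defines a closed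
      one.\<close>
    unfolding Ball_def
    by (intro closed_Collect_conj closed_Collect_all closed_Collect_imp open_Collect_const
        closed_Collect_eq closed_Collect_le continuous_intros continuous_on_product_coordinates)
  moreover have "compact (({1..n} \<times> Pow {1..m}) \<rightarrow>\<^sub>E {0..1::real})"
    by (intro compact_PiE_fun compact_Icc)
  ultimately have "compact ((({1..n} \<times> Pow {1..m}) \<rightarrow>\<^sub>E {0..1::real}) \<inter> {x.
      (\<forall>i\<in>{1..n}. \<forall>S\<in>Pow {1..m} - ?F i. x (i, S) = 0) \<and>
      (\<forall>i\<in>{1..n}. (\<Sum>S\<in>?F i. x (i, S)) \<le> 1)})"
    by (rule compact_Int_closed[rotated])
  then show ?thesis
    by (simp add: gap_R_def Int_def)
qed

text \<open>Each output coordinate is a sum of input coordinates on the index grid and the constant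
  \<open>undefined\<close> off it.\<close>

lemma continuous_on_gap_phi: "continuous_on X (gap_phi n m)"
proof -
  have "continuous_on X (\<lambda>x. gap_phi n m x p)" for p
    by (cases "p \<in> {1..n} \<times> {1..m}")
      (auto simp: gap_phi_def restrict_def split_beta
        intro!: continuous_intros continuous_on_subset[OF continuous_on_product_coordinates])
  then show ?thesis
    by (rule continuous_on_coordinatewise_then_product)
qed

lemma compact_gap_P: "compact (gap_P n m w C)"
  unfolding gap_P_def by (intro compact_continuous_image continuous_on_gap_phi compact_gap_R)

lemma continuous_on_gap_F: "continuous_on X (gap_F n m v \<sigma>)"
  unfolding gap_F_def
  by (intro continuous_intros continuous_on_subset[OF continuous_on_product_coordinates]) auto

lemma gap_allocation_point_in_P:
  assumes "A \<in> gap_allocations n m w C"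
  shows "(\<lambda>(i, j)\<in>{1..n} \<times> {1..m}. of_bool (j \<in> A i)) \<in> gap_P n m w C"
proof -
  have A: "A i \<in> gap_feasible_sets m w C i" "A i \<subseteq> {1..m}" if "i \<in> {1..n}" for i
    using assms that by (auto simp: gap_allocations_def gap_feasible_sets_def PiE_iff)
  \<comment> \<open>Bin \<open>i\<close> puts its whole unit of mass on the single set
    \<open>A i\<close>.\<close>
  define x :: "nat \<times> nat set \<Rightarrow> real"
    where "x = (\<lambda>(i, S)\<in>{1..n} \<times> Pow {1..m}. of_bool (S = A i))"
  \<comment> \<open>Used for two families: the feasible sets, for membership in
    \<open>gap_R\<close>, and the sets containing \<open>j\<close>, for the value of
    \<open>gap_phi\<close>.\<close>
  have sum_x: "(\<Sum>S\<in>\<S>. x (i, S)) = of_bool (A i \<in> \<S>)"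
    if "i \<in> {1..n}" "\<S> \<subseteq> Pow {1..m}" for i \<S>
  proof -
    have "(\<Sum>S\<in>\<S>. x (i, S)) = (\<Sum>S\<in>\<S>. if S = A i then 1 else 0)"
      using that by (intro sum.cong) (auto simp: x_def)
    also have "\<dots> = of_bool (A i \<in> \<S>)"
      using finite_subset[OF that(2)] by simp
    finally show ?thesis .
  qed
  have "x \<in> gap_R n m w C"
    unfolding gap_R_def
  proof (intro CollectI conjI ballI)
    fix i assume "i \<in> {1..n}"
    then show "(\<Sum>S\<in>gap_feasible_sets m w C i. x (i, S)) \<le> 1"
      by (subst sum_x) (auto simp: gap_feasible_sets_def)
  qed (use A(1) in \<open>auto simp: x_def\<close>)
  moreover have "gap_phi n m x = (\<lambda>(i, j)\<in>{1..n} \<times> {1..m}. of_bool (j \<in> A i))"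
    unfolding gap_phi_def
  proof (intro restrict_ext, clarify)
    fix i j assume "i \<in> {1..n}" "j \<in> {1..m}"
    then show "(\<Sum>S\<in>{S \<in> Pow {1..m}. j \<in> S}. x (i, S)) = of_bool (j \<in> A i)"
      using A(2) by (subst sum_x) auto
  qed
  ultimately show ?thesis
    unfolding gap_P_def by (metis imageI)
qed

lemma sum_of_bool_disjoint_family_le_1:
  assumes "disjoint_family_on A I" "finite I"
  shows "(\<Sum>i\<in>I. of_bool (j \<in> A i)) \<le> (1::real)"
proof -
  have "card {i \<in> I. j \<in> A i} \<le> 1"
    using assms by (auto simp: card_le_Suc0_iff_eq disjoint_family_on_def)
  moreover have "(\<Sum>i\<in>I. of_bool (j \<in> A i)) = real (card {i \<in> I. j \<in> A i})"
    using assms(2) by (simp add: of_bool_def sum.If_cases Int_def)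
  ultimately show ?thesis
    by simp
qed

theorem lemma3p3:
  fixes n m :: nat
    and v w :: "nat \<Rightarrow> nat \<Rightarrow> real"
    and C :: "nat \<Rightarrow> real"
    and \<sigma> :: "nat \<Rightarrow> nat \<Rightarrow> nat"
  assumes "\<And>i j. i \<in> {1..n} \<Longrightarrow> j \<in> {1..m} \<Longrightarrow> 0 \<le> v i j"
    and "\<And>i j. i \<in> {1..n} \<Longrightarrow> j \<in> {1..m} \<Longrightarrow> 0 \<le> w i j"
    and "\<And>i. i \<in> {1..n} \<Longrightarrow> 0 \<le> C i"
    and "gap_sorting n m v \<sigma>"
  shows "\<exists>y\<in>gap_P n m w C.
           (\<forall>z\<in>gap_P n m w C. gap_F n m v \<sigma> z \<le> gap_F n m v \<sigma> y) \<and>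
           gap_F n m v \<sigma> y \<ge> (1 - 1 / exp 1) * gap_OPT n m v w C"
proof -
  have "gap_OPT n m v w C \<in> gap_welfare n v ` gap_allocations n m w C"
    unfolding gap_OPT_def
    using gap_allocations_nonempty[of n C m w] assms(3) finite_gap_allocations[of n m w C]
    by (intro Max_in) blast+
  then obtain A where A: "A \<in> gap_allocations n m w C"
    and OPT: "gap_OPT n m v w C = gap_welfare n v A"
    by blast
  have subset: "A i \<subseteq> {1..m}" if "i \<in> {1..n}" for i
    using A that by (auto simp: gap_allocations_def gap_feasible_sets_def PiE_iff)
  have disj: "disjoint_family_on A {1..n}"
    using A by (simp add: gap_allocations_def)
  define z :: "nat \<times> nat \<Rightarrow> real"
    where "z = (\<lambda>(i, j)\<in>{1..n} \<times> {1..m}. of_bool (j \<in> A i))"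
  have z: "z \<in> gap_P n m w C"
    unfolding z_def by (rule gap_allocation_point_in_P[OF A])
  have "(\<Sum>j\<in>A i. v i j) = (\<Sum>j=1..m. v i j * z (i, j))" if "i \<in> {1..n}" for i
    \<comment> \<open>As \<open>A i\<close> lies inside \<open>{1..m}\<close>, the sum extends to
      all items by zero terms.\<close>
    using that subset[OF that] by (intro sum.mono_neutral_cong_left) (auto simp: z_def)
  then have "gap_OPT n m v w C = (\<Sum>i=1..n. \<Sum>j=1..m. v i j * z (i, j))"
    unfolding OPT gap_welfare_def by simp
  moreover have "(1 - 1 / exp 1) * (\<Sum>i=1..n. \<Sum>j=1..m. v i j * z (i, j)) \<le> gap_F n m v \<sigma> z"
  proof (rule gap_F_ge_linear[OF assms(1,4)])
    fix j assume "j \<in> {1..m}"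
    then have "(\<Sum>i=1..n. z (i, j)) = (\<Sum>i=1..n. of_bool (j \<in> A i))"
      by (intro sum.cong) (auto simp: z_def)
    then show "(\<Sum>i=1..n. z (i, j)) \<le> 1"
      using sum_of_bool_disjoint_family_le_1[OF disj] by simp
  qed (auto simp: z_def)
  \<comment> \<open>A continuous function on a compact set attains its maximum; \<open>z\<close>
    shows that \<open>gap_P\<close> is nonempty, and the maximizer then inherits the bound proved
    for \<open>z\<close>.\<close>
  moreover obtain y where "y \<in> gap_P n m w C"
    "\<forall>z\<in>gap_P n m w C. gap_F n m v \<sigma> z \<le> gap_F n m v \<sigma> y"
    using continuous_attains_sup[OF compact_gap_P _ continuous_on_gap_F] z by blast
  ultimately show ?thesis
    using z by (metis order_trans)
qed

end
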